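(* Let $g$ and $h$ be maps from $\mathbb{Z}$ to an additive abelian group $G$ with positive integer periods $m$ and $n$ respectively. Then $\{g(x)-h(x):\ x\in\mathbb{Z}\}$ is contained in the subgroup of $G$ generated by those $g(r)-h(r)$ with $0\leqslant r<m+n-\gcd(m,n)$ ($r$ an integer); in particular, $g$ and $h$ are identical if $g(r)=h(r)$ for all $r=0,\ldots,m+n-\gcd(m,n)-1$.
   Context: A map $f$ on $\mathbb{Z}$ has period $n$ (a positive integer) if $f(x+n)=f(x)$ for all $x\in\mathbb{Z}$; $n$ need not be the least period. *)

theory Defs
  imports Main "HOL-Computational_Algebra.Group_Closure"
begin

text \<open>
  A period is a positive integer, not necessarily the least one.
\<close>

definition has_period :: "(int \<Rightarrow> 'a) \<Rightarrow> int \<Rightarrow> bool"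
  where "has_period f n \<longleftrightarrow> n > 0 \<and> (\<forall>x. f (x + n) = f x)"

end

theory Submission
  imports Defs
begin

text \<open>
  Put \<open>d = gcd m n\<close> and \<open>f = g - h\<close>. The sum of \<open>h\<close> over \<open>y, y + d, \<dots>, y + n - d\<close> does not change
  when \<open>y\<close> is replaced by \<open>y + d\<close>, hence not when it is replaced by \<open>y + m\<close>; the corresponding sum of
  \<open>g\<close> is invariant under \<open>y \<mapsto> y + m\<close> term by term. So the shift operator \<open>T\<close> satisfies
  \<open>(T\<^sup>m - 1) (1 + T\<^sup>d + \<dots> + T\<^sup>n\<^sup>-\<^sup>d) f = 0\<close>, a recurrence of order \<open>m + n - d\<close> whose leading and
  constant coefficients are units. Every value of \<open>f\<close> is therefore an integer combination of any
  \<open>m + n - d\<close> consecutive values that precede or follow it.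
\<close>

text \<open>Turns a recurrence of order \<open>L\<close> that can be solved for either end term into
  a statement about all integers. The window \<open>[0, L)\<close> grows one point at a time, to the
  right by \<open>up\<close> and to the left by \<open>down\<close>.\<close>

lemma window_extend:
  fixes L :: int
  assumes "L \<ge> 0"
    and window: "\<And>r. 0 \<le> r \<Longrightarrow> r < L \<Longrightarrow> P r"
    and up: "\<And>x. (\<And>r. x \<le> r \<Longrightarrow> r < x + L \<Longrightarrow> P r) \<Longrightarrow> P (x + L)"
    and down: "\<And>x. (\<And>r. x < r \<Longrightarrow> r \<le> x + L \<Longrightarrow> P r) \<Longrightarrow> P x"
  shows "P x"
proof -
  have right: "\<forall>r. 0 \<le> r \<and> r < L + int k \<longrightarrow> P r" for k
  proof (induction k)
    case 0
    then show ?case using window by simp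
  next
    case (Suc k)
    have "P (int k + L)" by (rule up) (use Suc in auto)
    show ?case
    proof (intro allI impI)
      fix r assume "0 \<le> r \<and> r < L + int (Suc k)"
      then consider "0 \<le> r" "r < L + int k" | "r = int k + L" by fastforce
      then show "P r" using Suc \<open>P (int k + L)\<close> by cases auto
    qed
  qed
  have left: "\<forall>r. - int k \<le> r \<and> r < L \<longrightarrow> P r" for k
  proof (induction k)
    case 0
    then show ?case using window by simp
  next
    case (Suc k)
    \<comment> \<open>The premise of \<open>down\<close> asks for \<open>P\<close> on
      \<open>[- int k, L - int k - 1]\<close>, which lies in the interval already covered.\<close>
    have "P (- int (Suc k))" by (rule down) (use Suc in auto)
    show ?case
    proof (intro allI impI)
      fix r assume "- int (Suc k) \<le> r \<and> r < L"
      then consider "- int k \<le> r" "r < L" | "r = - int (Suc k)" by fastforce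
      then show "P r" using Suc \<open>P (- int (Suc k))\<close> by cases auto
    qed
  qed
  show ?thesis
  proof (cases "x \<ge> 0")
    case True
    then show ?thesis using right[of "Suc (nat x)"] \<open>L \<ge> 0\<close> by auto
  next
    case False
    show ?thesis
    proof (cases "x < L")
      case True
      then show ?thesis using left[of "nat (- x)"] by auto
    qed (use False \<open>L \<ge> 0\<close> in auto)
  qed
qed

text \<open>A shift by \<open>d\<close> trades the first term \<open>h y\<close> for
  \<open>h (y + d * int q)\<close>, and these agree because \<open>d * int q\<close> is a period.
  Iterating \<open>m / d\<close> times gives the shift by \<open>m\<close>.\<close>

lemma period_sum_invariant:
  fixes h :: "int \<Rightarrow> 'a :: ab_group_add"
  assumes "\<And>x. h (x + d * int q) = h x" and "d dvd m" and "m \<ge> 0" and "d > 0"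
  shows "(\<Sum>i<q. h (x + m + d * int i)) = (\<Sum>i<q. h (x + d * int i))"
proof -
  have shift: "(\<Sum>i<q. h (y + d + d * int i)) = (\<Sum>i<q. h (y + d * int i))" for y
  proof -
    have "(\<Sum>i<q. h (y + d * int i)) + h (y + d * int q) = (\<Sum>i<Suc q. h (y + d * int i))"
      by simp
    also have "\<dots> = h y + (\<Sum>i<q. h (y + d + d * int i))"
      by (subst sum.lessThan_Suc_shift) (simp add: algebra_simps)
    finally show ?thesis using assms(1)[of y] by simp
  qed
  obtain c where c: "m = d * c" using \<open>d dvd m\<close> ..
  then have "c \<ge> 0" using assms(3,4) by (simp add: zero_le_mult_iff)
  have "(\<Sum>i<q. h (x + d * int j + d * int i)) = (\<Sum>i<q. h (x + d * int i))" for j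
  proof (induction j)
    case (Suc j)
    then show ?case using shift[of "x + d * int j"] by (simp add: algebra_simps)
  qed simp
  from this[of "nat c"] show ?thesis using c \<open>c \<ge> 0\<close> by simp
qed

lemma group_closure_sum:
  "(\<And>i. i \<in> A \<Longrightarrow> f i \<in> group_closure S) \<Longrightarrow> sum f A \<in> group_closure S"
  by (induction A rule: infinite_finite_induct) (auto intro: group_closure_add)

theorem corollary1p1:
  fixes g h :: "int \<Rightarrow> 'a :: ab_group_add"
    and m n :: int
  assumes "has_period g m"
    and "has_period h n"
  shows "{g x - h x | x. x \<in> UNIV}
           \<subseteq> group_closure {g r - h r | r. 0 \<le> r \<and> r < m + n - gcd m n}
         \<and> ((\<forall>r. 0 \<le> r \<and> r \<le> m + n - gcd m n - 1 \<longrightarrow> g r = h r) \<longrightarrow> g = h)"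
proof -
  define d where "d = gcd m n"
  define f where "f x = g x - h x" for x
  define S where "S = {g r - h r | r. 0 \<le> r \<and> r < m + n - gcd m n}"
  have "m > 0" "n > 0" and g: "g (x + m) = g x" and h: "h (x + n) = h x" for x
    using assms by (auto simp: has_period_def)
  have "d > 0" "d dvd m" "d dvd n" using \<open>m > 0\<close> by (auto simp: d_def)
  obtain c where c: "n = d * c" using \<open>d dvd n\<close> ..
  then have "c > 0" using \<open>n > 0\<close> \<open>d > 0\<close> by (simp add: zero_less_mult_iff)
  \<comment> \<open>The sums have \<open>n / d = Suc k\<close> terms; the successor form lets one
    end term be split off each sum.\<close>
  define k where "k = nat (c - 1)"
  have n: "n = d * int (Suc k)" using c \<open>c > 0\<close> by (simp add: k_def)
  define L where "L = m + d * int k"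
  have L: "L = m + n - gcd m n" using n unfolding L_def d_def[symmetric] by (simp add: algebra_simps)
  have "L > 0" using \<open>m > 0\<close> \<open>d > 0\<close> by (simp add: L_def add_pos_nonneg)
  have "(\<Sum>i<Suc k. f (x + m + d * int i)) = (\<Sum>i<Suc k. f (x + d * int i))" for x
  proof -
    have "(\<Sum>i<Suc k. g (x + m + d * int i)) = (\<Sum>i<Suc k. g (x + d * int i))"
      using g[of "x + d * int i" for i] by (simp only: add.assoc add.commute[of m])
    moreover have "(\<Sum>i<Suc k. h (x + m + d * int i)) = (\<Sum>i<Suc k. h (x + d * int i))"
      by (rule period_sum_invariant) (use h n \<open>d > 0\<close> \<open>m > 0\<close> \<open>d dvd m\<close> in auto)
    ultimately show ?thesis unfolding f_def sum_subtractf by (simp only:)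
  qed
  \<comment> \<open>The last term on the left is \<open>f (x + L)\<close>, the first on the right is
    \<open>f x\<close>. Both have coefficient 1, so the recurrence can be solved for either.\<close>
  then have rec: "(\<Sum>i<k. f (x + m + d * int i)) + f (x + L)
      = f x + (\<Sum>i<k. f (x + d * int (Suc i)))" for x
    by (subst (asm) (2) sum.lessThan_Suc_shift) (simp add: L_def add.assoc)
  \<comment> \<open>This and the next two facts, with \<open>m > 0\<close>, place all remaining
    arguments in the recurrence strictly between \<open>x\<close> and \<open>x + L\<close>.\<close>
  have bound: "d * int (Suc i) \<le> d * int k" if "i < k" for i
    using that \<open>d > 0\<close> by (intro mult_left_mono) auto
  have pos: "0 \<le> d * int i" for i using \<open>d > 0\<close> by simp
  have less: "d * int i < d * int (Suc i)" for i using \<open>d > 0\<close> by simp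
  have closure: "f x \<in> group_closure S" for x
  proof (rule window_extend[where L = L])
    fix r assume "0 \<le> r" "r < L"
    then show "f r \<in> group_closure S"
      by (intro group_closure.base) (auto simp: S_def f_def L)
  next
    fix x assume window: "\<And>r. x \<le> r \<Longrightarrow> r < x + L \<Longrightarrow> f r \<in> group_closure S"
    have "f (x + L) = f x + (\<Sum>i<k. f (x + d * int (Suc i))) - (\<Sum>i<k. f (x + m + d * int i))"
      using rec[of x] by (simp add: algebra_simps)
    also have "\<dots> \<in> group_closure S"
    proof (intro group_closure.diff group_closure_add group_closure_sum window)
      fix i assume "i \<in> {..<k}"
      then have "i < k" by simp
      note b = bound[OF this] pos[of i] pos[of "Suc i"] less[of i] \<open>m > 0\<close>
      show "x \<le> x + d * int (Suc i)" "x + d * int (Suc i) < x + L"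
        "x \<le> x + m + d * int i" "x + m + d * int i < x + L"
        using b unfolding L_def by linarith+
    qed (use \<open>L > 0\<close> in auto)
    finally show "f (x + L) \<in> group_closure S" .
  next
    fix x assume window: "\<And>r. x < r \<Longrightarrow> r \<le> x + L \<Longrightarrow> f r \<in> group_closure S"
    have "f x = (\<Sum>i<k. f (x + m + d * int i)) + f (x + L) - (\<Sum>i<k. f (x + d * int (Suc i)))"
      using rec[of x] by (simp add: algebra_simps)
    also have "\<dots> \<in> group_closure S"
    proof (intro group_closure.diff group_closure_add group_closure_sum window)
      fix i assume "i \<in> {..<k}"
      then have "i < k" by simp
      note b = bound[OF this] pos[of i] pos[of "Suc i"] less[of i] \<open>m > 0\<close>
      show "x < x + d * int (Suc i)" "x + d * int (Suc i) \<le> x + L"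
        "x < x + m + d * int i" "x + m + d * int i \<le> x + L"
        using b unfolding L_def by linarith+
    qed (use \<open>L > 0\<close> in auto)
    finally show "f x \<in> group_closure S" .
  qed (use \<open>L > 0\<close> in auto)
  have "g = h" if "\<forall>r. 0 \<le> r \<and> r \<le> m + n - gcd m n - 1 \<longrightarrow> g r = h r"
  proof
    fix x
    \<comment> \<open>The generators vanish, so the group they generate is trivial.\<close>
    have "S \<subseteq> {0}" using that by (auto simp: S_def)
    have "y = 0" if "y \<in> group_closure S" for y
      using that by induction (use \<open>S \<subseteq> {0}\<close> in auto)
    from this[OF closure[of x]] show "g x = h x" by (simp add: f_def)
  qed
  then show ?thesis using closure by (auto simp: S_def f_def)
qed

end
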